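(* The Bergman projection $P$ on the bidisc $\mathbb{D}^2$ is of weak-type $L\log^+L$: there is a constant $C>0$ such that for all $f\in L\log^+L(\mathbb{D}^2)$ and all $\lambda>0$, $$\left|\{z\in\mathbb{D}^2 : |P(f)(z)|>\lambda\}\right| \le \frac{C\,\|f\|_{L\log^+L(\mathbb{D}^2)}}{\lambda}.$$
   Context: $\mathbb{D}$ is the unit disc, $dV$ Lebesgue measure, $|U|$ the Lebesgue measure of $U$. The Bergman projection on $\mathbb{D}^2$ is $P(f)(z)=\int_{\mathbb{D}^2}\prod_{j=1}^2\frac{1}{\pi(1-z_j\bar w_j)^2}f(w)\,dV(w)$ (the orthogonal projection of $L^2$ onto holomorphic $L^2$ functions, extended by this integral formula to $L^1$). Let $\log^+x=\max\{0,\log x\}$ for $x>0$ and $\log^+0=0$. For a domain $\Omega$ and integer $k\ge 0$, $L(\log^+L)^k(\Omega)$ is the Orlicz space of measurable $f$ with finite Luxemburg norm $\|f\|_{L(\log^+L)^k(\Omega)}=\inf\{\lambda>0:\int_\Omega |f/\lambda|(\log^+|f/\lambda|)^k\,dV\le 1\}$; $L\log^+L$ denotes the case $k=1$. *)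

theory Defs
  imports "HOL-Analysis.Analysis"
begin

definition bidisc :: "(complex \<times> complex) set" where
  "bidisc = ball 0 1 \<times> ball 0 1"

definition logplus :: "real \<Rightarrow> real" where
  "logplus x = (if x > 0 then max 0 (ln x) else 0)"

definition bergman_kernel :: "complex \<times> complex \<Rightarrow> complex \<times> complex \<Rightarrow> complex" where
  "bergman_kernel z w =
     (1 / (of_real pi * (1 - fst z * cnj (fst w)) ^ 2)) *
     (1 / (of_real pi * (1 - snd z * cnj (snd w)) ^ 2))"

definition bergman_proj ::
  "(complex \<times> complex \<Rightarrow> complex) \<Rightarrow> complex \<times> complex \<Rightarrow> complex" where
  "bergman_proj f z = (\<integral>w\<in>bidisc. bergman_kernel z w * f w \<partial>lebesgue)"

definition orlicz_modular ::
  "nat \<Rightarrow> ('a::euclidean_space) set \<Rightarrow> ('a \<Rightarrow> complex) \<Rightarrow> ennreal" where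
  "orlicz_modular k \<Omega> f =
     (\<integral>\<^sup>+ x\<in>\<Omega>. ennreal (norm (f x) * (logplus (norm (f x))) ^ k) \<partial>lebesgue)"

text \<open>The Orlicz space L(log^+ L)^k(\<Omega>): measurable f with finite Luxemburg norm.\<close>
definition LlogL :: "nat \<Rightarrow> ('a::euclidean_space) set \<Rightarrow> ('a \<Rightarrow> complex) set" where
  "LlogL k \<Omega> = {f. f \<in> borel_measurable (restrict_space lebesgue \<Omega>) \<and>
      (\<exists>t>0. orlicz_modular k \<Omega> (\<lambda>x. f x / of_real t) \<le> 1)}"

definition LlogL_norm :: "nat \<Rightarrow> ('a::euclidean_space) set \<Rightarrow> ('a \<Rightarrow> complex) \<Rightarrow> real" where
  "LlogL_norm k \<Omega> f = Inf {t. t > 0 \<and> orlicz_modular k \<Omega> (\<lambda>x. f x / of_real t) \<le> 1}"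

end

theory Submission
  imports Defs
begin

text \<open>
  Taking absolute values, \<open>P\<close> is dominated by the product of two copies of the positive operator
  with kernel \<open>\<rho>(z,w)\<^sup>-\<^sup>2\<close>, where \<open>\<rho>(z,w) = \<bar>1 - z w\<^sup>*\<bar>\<close>. On the disc this operator is of weak
  type (1,1); applying this in the first variable and integrating over the second leaves the
  integral of \<open>\<bar>f(w)\<bar>\<close> against the mass \<open>\<integral> \<rho>(z,w\<^sub>2)\<^sup>-\<^sup>2 dV(z)\<close>, which is of size
  \<open>log (1 / (1 - \<bar>w\<^sub>2\<bar>))\<close> and is absorbed by Young's inequality. Homogeneity gives the norm.

  The weak type (1,1) bound on the disc is obtained by duality: every set \<open>E\<close> contains a set \<open>A\<close>
  of at least half its measure whose potential is bounded everywhere. Since \<open>\<rho>\<close> satisfies the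
  triangle inequality, a potential is controlled by its values on the set \<open>A\<close> generating it, so
  one may take for \<open>A\<close> the points of \<open>E\<close> where the potential of \<open>E\<close> is at most twice a
  bound for its mean over \<open>E\<close>. This mean is bounded because, for fixed \<open>z\<close>, the kernel has bounded integral over the
  annulus \<open>\<bar>z\<bar> \<le> \<bar>w\<bar> < 1\<close>.
\<close>

section \<open>Geometry of the kernel distance\<close>

text \<open>The function called \<rho> in the overview; up to the factor \<open>1 / pi\<close>, its
  inverse square is the modulus of the Bergman kernel of the disc. It is not a metric:
  \<open>bdist z z\<close> equals 1 - |z|^2.\<close>

definition bdist :: "complex \<Rightarrow> complex \<Rightarrow> real" where
  "bdist z w = cmod (1 - z * cnj w)"

lemma bdist_commute: "bdist z w = bdist w z"
proof -
  have "cmod (1 - z * cnj w) = cmod (cnj (1 - z * cnj w))" by (rule complex_mod_cnj[symmetric])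
  also have "cnj (1 - z * cnj w) = 1 - w * cnj z" by simp
  finally show ?thesis by (simp add: bdist_def)
qed

lemma bdist_ge:
  assumes "cmod w \<le> 1"
  shows "1 - cmod z \<le> bdist z w"
proof -
  have "cmod (z * cnj w) \<le> cmod z"
    using assms by (simp add: norm_mult mult_left_le)
  then show ?thesis
    unfolding bdist_def using norm_triangle_ineq2[of 1 "z * cnj w"] by simp
qed

lemma bdist_pos: "cmod z < 1 \<Longrightarrow> cmod w \<le> 1 \<Longrightarrow> 0 < bdist z w"
  using bdist_ge[of w z] by simp

lemma bdist_le_2:
  assumes "cmod z \<le> 1" "cmod w \<le> 1"
  shows "bdist z w \<le> 2"
proof -
  have "cmod (z * cnj w) \<le> 1"
    using assms by (simp add: norm_mult mult_le_one)
  then show ?thesis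
    unfolding bdist_def using norm_triangle_ineq4[of 1 "z * cnj w"] by simp
qed

text \<open>The difference of the squares factors as (1 - |u|^2)(1 - |w|^2), the identity behind the
  pseudohyperbolic distance.\<close>

lemma norm_diff_le_bdist:
  assumes "cmod u \<le> 1" "cmod w \<le> 1"
  shows "cmod (u - w) \<le> bdist u w"
proof -
  have "(bdist u w)\<^sup>2 - (cmod (u - w))\<^sup>2 = (1 - (cmod u)\<^sup>2) * (1 - (cmod w)\<^sup>2)"
    unfolding bdist_def cmod_power2 by (simp add: algebra_simps power2_eq_square)
  moreover have "\<dots> \<ge> 0"
    using assms by (intro mult_nonneg_nonneg) (simp_all add: power_le_one)
  ultimately have "(cmod (u - w))\<^sup>2 \<le> (bdist u w)\<^sup>2" by simp
  then show ?thesis by (rule power2_le_imp_le) (simp add: bdist_def)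
qed

text \<open>Replacing \<open>u\<close> by \<open>w\<close> in the second slot changes 1 - z u* by z
  (u - w)*, whose modulus is at most |u - w| and hence at most \<open>bdist u w\<close>.\<close>

lemma bdist_triangle:
  assumes "cmod z \<le> 1" "cmod u \<le> 1" "cmod w \<le> 1"
  shows "bdist z w \<le> bdist z u + bdist u w"
proof -
  have "bdist z w = cmod ((1 - z * cnj u) + z * cnj (u - w))"
    by (simp add: bdist_def algebra_simps)
  also have "\<dots> \<le> bdist z u + cmod z * cmod (u - w)"
    unfolding bdist_def by (rule order_trans[OF norm_triangle_ineq]) (simp add: norm_mult flip: complex_cnj_diff)
  also have "cmod z * cmod (u - w) \<le> bdist u w"
    using assms norm_diff_le_bdist[of u w] mult_left_le_one_le[of "cmod (u-w)" "cmod z"] by simp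
  finally show ?thesis by simp
qed

lemma bdist_measurable [measurable]:
  assumes [measurable]: "f \<in> borel_measurable M" "g \<in> borel_measurable M"
  shows "(\<lambda>x. bdist (f x) (g x)) \<in> borel_measurable M"
proof -
  have [measurable]: "cnj \<in> borel_measurable borel"
    by (intro borel_measurable_continuous_onI continuous_intros)
  show ?thesis unfolding bdist_def by measurable
qed

section \<open>Dyadic integration of powers of the kernel distance\<close>

lemma emeasure_lborel_cball_complex:
  assumes "r \<ge> 0"
  shows "emeasure lborel (cball (c::complex) r) = ennreal (pi * r\<^sup>2)"
  using emeasure_cball[OF assms, of c] assms
  by (simp add: unit_ball_vol_2 ennreal_mult'' ennreal_power)

text \<open>By the triangle inequality through \<open>z\<close>, any two points of this set are at
  Euclidean distance at most \<open>2 * r\<close>, so a disc of that radius around any one of its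
  points contains it.\<close>

lemma emeasure_bdist_le:
  assumes z: "cmod z < 1" and r: "r \<ge> 0"
  shows "emeasure lborel {w \<in> ball 0 1. bdist z w \<le> r} \<le> ennreal (4 * pi * r\<^sup>2)"
proof (cases "{w \<in> ball 0 1. bdist z w \<le> r} = {}")
  case True
  then show ?thesis by (simp only: emeasure_empty) simp
next
  case False
  then obtain w0 where w0: "cmod w0 < 1" "bdist z w0 \<le> r" by auto
  have "{w \<in> ball 0 1. bdist z w \<le> r} \<subseteq> cball w0 (2 * r)"
  proof
    fix w assume w: "w \<in> {w \<in> ball 0 1. bdist z w \<le> r}"
    have "cmod (w0 - w) \<le> bdist w0 w" using w w0 by (intro norm_diff_le_bdist) auto
    also have "\<dots> \<le> bdist w0 z + bdist z w" using w w0 z by (intro bdist_triangle) auto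
    also have "\<dots> \<le> 2 * r" using w w0 by (simp add: bdist_commute)
    finally show "w \<in> cball w0 (2 * r)" by (simp add: dist_norm)
  qed
  then have "emeasure lborel {w \<in> ball 0 1. bdist z w \<le> r} \<le> emeasure lborel (cball w0 (2 * r))"
    by (intro emeasure_mono) auto
  then show ?thesis using r by (simp add: emeasure_lborel_cball_complex mult_ac)
qed

lemma dyadic_scale:
  assumes "0 < x" "x \<le> (1::real)"
  obtains k :: nat where "(1/2) ^ Suc k < x" "x \<le> (1/2) ^ k"
proof -
  obtain m where m: "(1/2::real) ^ m < x"
    using real_arch_pow_inv[of x "1/2"] assms by auto
  define k where "k = (LEAST k. (1/2::real) ^ k < x)"
  have k: "(1/2::real) ^ k < x" unfolding k_def by (rule LeastI[of _ m]) (rule m)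
  then have "k \<noteq> 0" using assms by (intro notI) simp
  then obtain j where j: "k = Suc j" by (cases k) auto
  have "\<not> (1/2::real) ^ j < x" using not_less_Least[of j "\<lambda>k. (1/2::real) ^ k < x"] j k_def by simp
  then show ?thesis using that[of j] k j by simp
qed

text \<open>The disc is covered by sublevel sets of \<open>bdist z\<close> at the scales 2 * 2^-k,
  the factor 2 being the largest value of the distance. At scale \<open>k\<close> the integrand is
  at most 2^(kp), on an area of at most 16 pi / 4^k.\<close>

lemma nn_integral_bdist_dyadic:
  assumes z: "cmod z < 1" and n: "(1/2) ^ Suc n \<le> 1 - cmod z"
  shows "(\<integral>\<^sup>+w. ennreal (1 / bdist z w ^ p) * indicator (ball 0 1) w \<partial>lborel)
    \<le> ennreal (\<Sum>k\<le>n+2. 16 * pi * 2 ^ (k * p) / 4 ^ k)"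
proof -
  define S where "S k = {w \<in> ball 0 1. bdist z w \<le> 2 * (1/2)^k}" for k :: nat
  have S_meas [measurable]: "S k \<in> sets borel" for k
    unfolding S_def by measurable
  have pt: "ennreal (1 / bdist z w ^ p) * indicator (ball 0 1) w
      \<le> (\<Sum>k\<le>n+2. ennreal (2 ^ (k * p)) * indicator (S k) w)" for w
  proof (cases "cmod w < 1")
    case True
    have pos: "0 < bdist z w / 2" using bdist_pos[of z w] z True by simp
    moreover have "bdist z w / 2 \<le> 1" using bdist_le_2[of z w] z True by simp
    ultimately obtain k where k: "(1/2) ^ Suc k < bdist z w / 2" "bdist z w / 2 \<le> (1/2) ^ k"
      by (rule dyadic_scale)
    \<comment> \<open>The distance never falls below 1 - |z|, so scales finer than
      \<open>n + 2\<close> do not occur.\<close>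
    have "(1/2) ^ Suc n \<le> 2 * (1/2::real) ^ k"
      using n bdist_ge[of w z] True k by simp
    then have "(1/2::real) ^ (n + 2) \<le> (1/2) ^ k" by simp
    then have kn: "k \<le> n + 2" by (subst (asm) power_decreasing_iff) auto
    have "1 / bdist z w \<le> 2 ^ k"
      using k pos by (simp add: field_simps power_one_over)
    then have "(1 / bdist z w) ^ p \<le> (2 ^ k) ^ p"
      using pos by (intro power_mono) auto
    then have "ennreal (1 / bdist z w ^ p) * indicator (ball 0 1) w
        \<le> ennreal (2 ^ (k * p)) * indicator (S k) w"
      using True k by (auto simp: power_divide power_mult S_def intro!: ennreal_leI)
    also have "\<dots> \<le> (\<Sum>k\<le>n+2. ennreal (2 ^ (k * p)) * indicator (S k) w)"
      using kn by (intro member_le_sum) auto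
    finally show ?thesis .
  qed auto
  have "(\<integral>\<^sup>+w. ennreal (1 / bdist z w ^ p) * indicator (ball 0 1) w \<partial>lborel)
      \<le> (\<integral>\<^sup>+w. (\<Sum>k\<le>n+2. ennreal (2 ^ (k * p)) * indicator (S k) w) \<partial>lborel)"
    by (intro nn_integral_mono pt)
  also have "\<dots> = (\<Sum>k\<le>n+2. ennreal (2 ^ (k * p)) * emeasure lborel (S k))"
    by (subst nn_integral_sum) (auto simp: nn_integral_cmult_indicator)
  also have "\<dots> \<le> (\<Sum>k\<le>n+2. ennreal (2 ^ (k * p)) * ennreal (4 * pi * (2 * (1/2)^k)\<^sup>2))"
    unfolding S_def by (intro sum_mono mult_left_mono emeasure_bdist_le z) auto
  also have "\<dots> = (\<Sum>k\<le>n+2. ennreal (16 * pi * 2 ^ (k * p) / 4 ^ k))"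
  proof (intro sum.cong refl)
    fix k
    have "((1/2)^k)\<^sup>2 = (1 / 4 ^ k :: real)"
      by (simp add: power2_eq_square power_one_over flip: power_mult_distrib)
    then show "ennreal (2 ^ (k * p)) * ennreal (4 * pi * (2 * (1/2)^k)\<^sup>2)
      = ennreal (16 * pi * 2 ^ (k * p) / 4 ^ k)"
      by (simp add: ennreal_mult'' [symmetric] power_mult_distrib field_simps)
  qed
  also have "\<dots> = ennreal (\<Sum>k\<le>n+2. 16 * pi * 2 ^ (k * p) / 4 ^ k)"
    by (intro sum_ennreal) auto
  finally show ?thesis .
qed

text \<open>The exponent 2 is critical: each of the \<open>n + 3\<close> scales contributes the same
  amount \<open>16 * pi\<close>. This is the source of the logarithm.\<close>

lemma nn_integral_bdist_inverse_square_le: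
  assumes "cmod z < 1" "(1/2) ^ Suc n \<le> 1 - cmod z"
  shows "(\<integral>\<^sup>+w. ennreal (1 / (bdist z w)\<^sup>2) * indicator (ball 0 1) w \<partial>lborel)
    \<le> ennreal (16 * pi * (real n + 3))"
proof -
  have "(2::real) ^ (k * 2) = 4 ^ k" for k unfolding mult.commute[of k] power_mult by simp
  then show ?thesis using nn_integral_bdist_dyadic[OF assms, of 2] by (simp add: algebra_simps)
qed

text \<open>For the exponent 3 the dyadic sum is geometric and dominated by its finest scale, where
  2^n is at most 1 / (1 - |z|).\<close>

lemma nn_integral_bdist_inverse_cube_le:
  assumes z: "cmod z < 1"
  shows "(\<integral>\<^sup>+w. ennreal (1 / bdist z w ^ 3) * indicator (ball 0 1) w \<partial>lborel)
    \<le> ennreal (128 * pi / (1 - cmod z))"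
proof -
  obtain n where n: "(1/2) ^ Suc n < 1 - cmod z" "1 - cmod z \<le> (1/2) ^ n"
    using dyadic_scale[of "1 - cmod z"] z by auto
  have "(2::real) ^ (k * 3) / 4 ^ k = 2 ^ k" for k
  proof -
    have "(2::real) ^ (k * 3) = (2 * 4) ^ k" unfolding mult.commute[of k] power_mult by simp
    then show ?thesis unfolding power_mult_distrib by simp
  qed
  then have e: "16 * pi * (2::real) ^ (k * 3) / 4 ^ k = 16 * pi * 2 ^ k" for k
    by (metis times_divide_eq_right)
  have "(\<Sum>k\<le>n+2. 16 * pi * (2::real) ^ (k * 3) / 4 ^ k) = 16 * pi * (\<Sum>k\<le>n+2. 2 ^ k)"
    unfolding e by (rule sum_distrib_left[symmetric])
  also have "(\<Sum>k\<le>n+2. (2::real) ^ k) = 2 ^ (n + 3) - 1"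
    using geometric_sum[of "2::real" "n+3"] by (simp add: lessThan_Suc_atMost eval_nat_numeral)
  also have "16 * pi * (2 ^ (n + 3) - 1) \<le> 128 * pi * 2 ^ n"
    by (simp add: power_add algebra_simps)
  also have "2 ^ n \<le> 1 / (1 - cmod z)"
    using n z by (simp add: field_simps power_one_over)
  then have "128 * pi * 2 ^ n \<le> 128 * pi / (1 - cmod z)"
    using mult_left_mono[of "2^n" "1 / (1 - cmod z)" "128 * pi"] by simp
  finally have "(\<Sum>k\<le>n+2. 16 * pi * (2::real) ^ (k * 3) / 4 ^ k) \<le> 128 * pi / (1 - cmod z)" .
  then show ?thesis
    using nn_integral_bdist_dyadic[OF z less_imp_le[OF n(1)], of 3] by (meson ennreal_leI order_trans)
qed

section \<open>Bounded kernel integral over the outer annulus\<close>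

lemma ball_in_sets_borel [measurable]: "ball (c::complex) r \<in> sets borel"
  by (rule borel_open) (rule open_ball)

text \<open>Substitution of \<open>q *\<^sub>R w\<close> for the variable; the Jacobian is
  \<open>q\<^sup>2\<close> because the plane has real dimension two.\<close>

lemma nn_integral_scale_disc:
  fixes f :: "complex \<Rightarrow> ennreal"
  assumes [measurable]: "f \<in> borel_measurable borel" and q: "q \<ge> 0"
  shows "ennreal (q\<^sup>2) * (\<integral>\<^sup>+w. f (q *\<^sub>R w) * indicator (ball 0 1) w \<partial>lborel)
    \<le> (\<integral>\<^sup>+w. f w * indicator (ball 0 q) w \<partial>lborel)"
proof (cases "q = 0")
  case False
  then have q: "q > 0" using q by simp
  have "(\<integral>\<^sup>+w. f w * indicator (ball 0 q) w \<partial>lborel)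
      = (\<integral>\<^sup>+w. ennreal (q\<^sup>2) * (f (q *\<^sub>R w) * indicator (ball 0 q) (q *\<^sub>R w)) \<partial>lborel)"
  proof -
    have "(\<integral>\<^sup>+w. f w * indicator (ball 0 q) w \<partial>lborel)
      = (\<integral>\<^sup>+w. f w * indicator (ball 0 q) w \<partial>density (distr lborel borel (\<lambda>w. q *\<^sub>R w)) (\<lambda>_. ennreal (q\<^sup>2)))"
      using q lborel_affine[of q "0::complex"] by simp
    then show ?thesis by (simp add: nn_integral_density nn_integral_distr)
  qed
  also have "\<dots> = (\<integral>\<^sup>+w. ennreal (q\<^sup>2) * (f (q *\<^sub>R w) * indicator (ball 0 1) w) \<partial>lborel)"
    using q by (intro nn_integral_cong) (auto split: split_indicator)
  also have "\<dots> = ennreal (q\<^sup>2) * (\<integral>\<^sup>+w. f (q *\<^sub>R w) * indicator (ball 0 1) w \<partial>lborel)"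
    by (rule nn_integral_cmult) measurable
  finally show ?thesis by simp
qed simp

text \<open>Applied with \<open>a = bdist z w\<close>, \<open>b = bdist z (q *\<^sub>R w)\<close>
  and \<open>d = 1 - q\<close>. The difference of squares is factored: 1/a - (1-d)/b is at most
  6d/a^2, the sum 1/a + (1-d)/b at most 3/a.\<close>

lemma inverse_square_increment_le:
  fixes a b d :: real
  assumes "b \<le> a + d" "a \<le> b + d" "d \<le> b" "a \<le> 2" "0 < a" "0 < d" "d \<le> 1"
  shows "1 / a\<^sup>2 \<le> (1 - d)\<^sup>2 / b\<^sup>2 + 18 * d / a ^ 3"
proof -
  have b: "b > 0" "a \<le> 2 * b" using assms by auto
  have inv: "1 / b \<le> 2 / a" using b assms by (simp add: field_simps)
  have "d * a \<le> d * 2" using assms by (intro mult_left_mono) auto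
  moreover have "b - (1 - d) * a = b - a + d * a" by (simp add: algebra_simps)
  ultimately have num: "b - (1 - d) * a \<le> 3 * d" using assms by linarith
  have "1 / a - (1 - d) / b = (b - (1 - d) * a) * (1 / b) / a"
    using b assms by (simp add: field_simps)
  also have "\<dots> \<le> (3 * d) * (1 / b) / a"
    using num b assms by (intro divide_right_mono mult_right_mono) auto
  also have "\<dots> \<le> (3 * d) * (2 / a) / a"
    using inv assms by (intro divide_right_mono mult_left_mono) auto
  finally have 1: "1 / a - (1 - d) / b \<le> 6 * d / a\<^sup>2" by (simp add: power2_eq_square)
  have "(1 - d) / b \<le> 1 / b" using assms b by (intro divide_right_mono) auto
  then have 2: "1 / a + (1 - d) / b \<le> 3 / a" using inv by (simp add: field_simps)
  have "1 / a\<^sup>2 - (1 - d)\<^sup>2 / b\<^sup>2 = (1 / a - (1 - d) / b) * (1 / a + (1 - d) / b)"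
    by (simp add: power2_eq_square algebra_simps)
  also have "\<dots> \<le> (6 * d / a\<^sup>2) * (1 / a + (1 - d) / b)"
    using 1 assms b by (intro mult_right_mono add_nonneg_nonneg divide_nonneg_nonneg) auto
  also have "\<dots> \<le> (6 * d / a\<^sup>2) * (3 / a)"
    using 2 assms by (intro mult_left_mono) auto
  also have "\<dots> = 18 * d / a ^ 3" by (simp add: eval_nat_numeral)
  finally show ?thesis by simp
qed

text \<open>
  With \<open>q = \<bar>z\<bar>\<close> and \<open>\<phi> = \<rho>(z,\<cdot>)\<^sup>-\<^sup>2\<close>, scaling turns the annulus integral into the integral over
  the whole disc of \<open>\<phi>(w) - q\<^sup>2 \<phi>(q w)\<close>, which gains a factor \<open>(1 - q) / \<rho>\<close> over \<open>\<phi>\<close>.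
\<close>

lemma nn_integral_bdist_annulus_le:
  assumes z: "cmod z < 1"
  shows "(\<integral>\<^sup>+w. ennreal (1 / (bdist z w)\<^sup>2) * indicator {w \<in> ball 0 1. cmod z \<le> cmod w} w \<partial>lborel)
    \<le> ennreal (2304 * pi)"
proof -
  define q d where "q = cmod z" and "d = 1 - cmod z"
  define \<phi> where "\<phi> w = ennreal (1 / (bdist z w)\<^sup>2)" for w
  have [measurable]: "\<phi> \<in> borel_measurable borel"
    unfolding \<phi>_def by measurable
  have d: "0 < d" "d \<le> 1" "q = 1 - d" and q: "q \<ge> 0" using z by (auto simp: d_def q_def)
  have pt: "\<phi> w * indicator (ball 0 1) w \<le> ennreal (q\<^sup>2) * (\<phi> (q *\<^sub>R w) * indicator (ball 0 1) w)
      + ennreal (18 * d) * (ennreal (1 / bdist z w ^ 3) * indicator (ball 0 1) w)" for w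
  proof (cases "cmod w < 1")
    case w: True
    have *: "cmod (d *\<^sub>R (z * cnj w)) \<le> d"
      using w z d by (simp add: norm_mult mult_le_one mult_left_le less_imp_le)
    have qw: "q *\<^sub>R w = of_real q * w" by (rule scaleR_conv_of_real)
    \<comment> \<open>Shrinking \<open>w\<close> to \<open>q *\<^sub>R w\<close> moves 1 - z w* by d
      z w*, so the two distances differ by at most \<open>d\<close>.\<close>
    have "1 - z * cnj (q *\<^sub>R w) = (1 - z * cnj w) + d *\<^sub>R (z * cnj w)"
      by (simp add: d qw scaleR_conv_of_real algebra_simps)
    then have "bdist z (q *\<^sub>R w) \<le> bdist z w + cmod (d *\<^sub>R (z * cnj w))"
      unfolding bdist_def by (simp only: norm_triangle_ineq)
    then have b1: "bdist z (q *\<^sub>R w) \<le> bdist z w + d" using * by linarith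
    have "1 - z * cnj w = (1 - z * cnj (q *\<^sub>R w)) - d *\<^sub>R (z * cnj w)"
      by (simp add: d qw scaleR_conv_of_real algebra_simps)
    then have "bdist z w \<le> bdist z (q *\<^sub>R w) + cmod (d *\<^sub>R (z * cnj w))"
      unfolding bdist_def by (simp only: norm_triangle_ineq4)
    then have b2: "bdist z w \<le> bdist z (q *\<^sub>R w) + d" using * by linarith
    have "cmod (q *\<^sub>R w) \<le> 1" using w z d by (simp add: q_def mult_le_one)
    then have b3: "d \<le> bdist z (q *\<^sub>R w)" unfolding d_def by (rule bdist_ge)
    have "1 / (bdist z w)\<^sup>2 \<le> q\<^sup>2 * (1 / (bdist z (q *\<^sub>R w))\<^sup>2) + 18 * d * (1 / bdist z w ^ 3)"
      using inverse_square_increment_le[OF b1 b2 b3] bdist_le_2[of z w] bdist_pos[of z w] w z d by simp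
    then have "\<phi> w \<le> ennreal (q\<^sup>2) * \<phi> (q *\<^sub>R w) + ennreal (18 * d) * ennreal (1 / bdist z w ^ 3)"
      unfolding \<phi>_def using d by (subst (1 2) ennreal_mult[symmetric]) (auto simp: bdist_def simp flip: ennreal_plus intro!: ennreal_leI)
    then show ?thesis using w by simp
  qed simp
  let ?I = "\<integral>\<^sup>+w. \<phi> w * indicator (ball 0 1) w \<partial>lborel"
  let ?A = "{w \<in> ball 0 1. cmod z \<le> cmod w}"
  let ?R = "\<integral>\<^sup>+w. \<phi> w * indicator (ball 0 q) w \<partial>lborel"
  have "?I \<le> (\<integral>\<^sup>+w. ennreal (q\<^sup>2) * (\<phi> (q *\<^sub>R w) * indicator (ball 0 1) w)
      + ennreal (18 * d) * (ennreal (1 / bdist z w ^ 3) * indicator (ball 0 1) w) \<partial>lborel)"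
    by (intro nn_integral_mono pt)
  also have "\<dots> = ennreal (q\<^sup>2) * (\<integral>\<^sup>+w. \<phi> (q *\<^sub>R w) * indicator (ball 0 1) w \<partial>lborel)
      + ennreal (18 * d) * (\<integral>\<^sup>+w. ennreal (1 / bdist z w ^ 3) * indicator (ball 0 1) w \<partial>lborel)"
    by (simp add: nn_integral_add nn_integral_cmult)
  also have "\<dots> \<le> ?R + ennreal (18 * d) * ennreal (128 * pi / d)"
    using nn_integral_bdist_inverse_cube_le[OF z] q
    by (intro add_mono mult_left_mono nn_integral_scale_disc) (auto simp: d_def)
  \<comment> \<open>The gained factor \<open>d\<close> cancels the 1/d growth of the cubic integral;
    18 * 128 = 2304.\<close>
  also have "ennreal (18 * d) * ennreal (128 * pi / d) = ennreal (2304 * pi)"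
    using d by (simp flip: ennreal_mult'')
  finally have I_le: "?I \<le> ?R + ennreal (2304 * pi)" .
  have "?R + (\<integral>\<^sup>+w. \<phi> w * indicator ?A w \<partial>lborel)
      = (\<integral>\<^sup>+w. \<phi> w * indicator (ball 0 q) w + \<phi> w * indicator ?A w \<partial>lborel)"
    by (intro nn_integral_add[symmetric]) measurable
  also have "\<dots> = ?I"
    using z by (intro nn_integral_cong) (auto simp: q_def split: split_indicator)
  finally have I_eq: "?R + (\<integral>\<^sup>+w. \<phi> w * indicator ?A w \<partial>lborel) = ?I" .
  \<comment> \<open>The logarithmic bound, though not uniform in \<open>z\<close>, shows that
    \<open>?I\<close> is finite, so \<open>?R\<close> may be cancelled.\<close>
  obtain n where n: "(1/2) ^ Suc n < 1 - cmod z"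
    using dyadic_scale[of "1 - cmod z"] z by auto
  have "?I \<le> ennreal (16 * pi * (real n + 3))"
    unfolding \<phi>_def by (intro nn_integral_bdist_inverse_square_le z less_imp_le n)
  then have "?I < \<infinity>" by (rule le_less_trans) simp
  moreover have "?R \<le> ?I" unfolding I_eq[symmetric] by simp
  ultimately have "?R \<noteq> top" using neq_top_trans by auto
  then have "(\<integral>\<^sup>+w. \<phi> w * indicator ?A w \<partial>lborel) \<le> ennreal (2304 * pi)"
    using I_le unfolding I_eq[symmetric] by simp
  then show ?thesis unfolding \<phi>_def .
qed

section \<open>Weak type (1,1) of the positive operator on the disc\<close>

text \<open>The kernel is cut off to the disc so that its potentials can be integrated over the whole plane.\<close>

definition berg :: "complex \<Rightarrow> complex \<Rightarrow> ennreal" where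
  "berg z w = ennreal (1 / (bdist z w)\<^sup>2) * indicator (ball 0 1 \<times> ball 0 1) (z, w)"

lemma berg_commute: "berg z w = berg w z"
  by (auto simp: berg_def bdist_commute split: split_indicator)

lemma berg_measurable [measurable]:
  assumes [measurable]: "f \<in> borel_measurable M" "g \<in> borel_measurable M"
  shows "(\<lambda>x. berg (f x) (g x)) \<in> borel_measurable M"
proof -
  have *: "berg (f x) (g x) = ennreal (1 / (bdist (f x) (g x))\<^sup>2)
      * indicator (ball 0 1) (f x) * indicator (ball 0 1) (g x)" for x
    by (auto simp: berg_def split: split_indicator)
  show ?thesis unfolding * by measurable
qed

text \<open>The kernel is symmetric, so it suffices to treat the pairs with |z| \<le> |w|; there the
  annulus bound applies for each fixed \<open>z\<close>.\<close>

lemma nn_integral_berg_sets_le: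
  assumes [measurable]: "E \<in> sets borel" and E: "E \<subseteq> ball 0 1"
  shows "(\<integral>\<^sup>+z. (\<integral>\<^sup>+w. berg z w * indicator E w \<partial>lborel) * indicator E z \<partial>lborel)
    \<le> ennreal (4608 * pi) * emeasure lborel E"
proof -
  define h where "h z w = berg z w * indicator {w. cmod z \<le> cmod w} w * indicator E w * indicator E z" for z w
  \<comment> \<open>The indicator of a set depending on \<open>z\<close> becomes a conditional, from
    which joint measurability can be derived.\<close>
  have h_eq: "h z w = berg z w * (if cmod z \<le> cmod w then 1 else 0) * indicator E w * indicator E z" for z w
    by (simp add: h_def)
  have [measurable]: "(\<lambda>x. h (f x) (g x)) \<in> borel_measurable M"
    if [measurable]: "f \<in> borel_measurable M" "g \<in> borel_measurable M" for f g and M :: "'b measure"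
    unfolding h_eq by measurable
  have [measurable]: "case_prod h \<in> borel_measurable (borel \<Otimes>\<^sub>M borel)"
    unfolding case_prod_unfold h_eq by measurable
  have inner: "(\<integral>\<^sup>+w. h z w \<partial>lborel) \<le> ennreal (2304 * pi) * indicator E z" for z
  proof (cases "z \<in> E")
    case True
    then have z: "cmod z < 1" using E by auto
    have "(\<integral>\<^sup>+w. h z w \<partial>lborel)
      \<le> (\<integral>\<^sup>+w. ennreal (1 / (bdist z w)\<^sup>2) * indicator {w \<in> ball 0 1. cmod z \<le> cmod w} w \<partial>lborel)"
      by (intro nn_integral_mono) (auto simp: h_def berg_def split: split_indicator)
    then show ?thesis using nn_integral_bdist_annulus_le[OF z] True by simp
  qed (simp add: h_def)
  have "(\<integral>\<^sup>+z. \<integral>\<^sup>+w. h z w \<partial>lborel \<partial>lborel) \<le> (\<integral>\<^sup>+z. ennreal (2304 * pi) * indicator E z \<partial>lborel)"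
    by (intro nn_integral_mono inner)
  also have "\<dots> = ennreal (2304 * pi) * emeasure lborel E"
    by (simp add: nn_integral_cmult_indicator)
  finally have half: "(\<integral>\<^sup>+z. \<integral>\<^sup>+w. h z w \<partial>lborel \<partial>lborel) \<le> ennreal (2304 * pi) * emeasure lborel E" .
  have "(\<integral>\<^sup>+z. (\<integral>\<^sup>+w. berg z w * indicator E w \<partial>lborel) * indicator E z \<partial>lborel)
    = (\<integral>\<^sup>+z. (\<integral>\<^sup>+w. berg z w * indicator E w * indicator E z \<partial>lborel) \<partial>lborel)"
    by (simp add: nn_integral_multc)
  \<comment> \<open>Pairs with |z| = |w| are counted twice, hence only an inequality.\<close>
  also have "\<dots> \<le> (\<integral>\<^sup>+z. (\<integral>\<^sup>+w. h z w + h w z \<partial>lborel) \<partial>lborel)"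
    by (intro nn_integral_mono) (auto simp: h_def berg_commute split: split_indicator)
  also have "\<dots> = (\<integral>\<^sup>+z. (\<integral>\<^sup>+w. h z w \<partial>lborel) + (\<integral>\<^sup>+w. h w z \<partial>lborel) \<partial>lborel)"
    by (intro nn_integral_cong nn_integral_add) measurable
  also have "\<dots> = (\<integral>\<^sup>+z. \<integral>\<^sup>+w. h z w \<partial>lborel \<partial>lborel) + (\<integral>\<^sup>+z. \<integral>\<^sup>+w. h w z \<partial>lborel \<partial>lborel)"
    by (intro nn_integral_add) measurable
  also have "(\<integral>\<^sup>+z. \<integral>\<^sup>+w. h w z \<partial>lborel \<partial>lborel) = (\<integral>\<^sup>+z. \<integral>\<^sup>+w. h z w \<partial>lborel \<partial>lborel)"
    by (intro lborel_pair.Fubini') simp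
  finally have "(\<integral>\<^sup>+z. (\<integral>\<^sup>+w. berg z w * indicator E w \<partial>lborel) * indicator E z \<partial>lborel)
    \<le> ennreal (2304 * pi) * emeasure lborel E + ennreal (2304 * pi) * emeasure lborel E"
    using half by (meson add_mono order_trans)
  also have "\<dots> = (ennreal (2304 * pi) + ennreal (2304 * pi)) * emeasure lborel E"
    by (simp add: distrib_right)
  also have "ennreal (2304 * pi) + ennreal (2304 * pi) = ennreal (4608 * pi)"
    by (subst ennreal_plus[symmetric]) (simp_all del: ennreal_plus)
  finally show ?thesis .
qed

text \<open>Choose \<open>u\<close> in \<open>A\<close> whose distance to \<open>w\<close> is less
  than twice the infimum \<open>i\<close>. For \<open>z\<close> in \<open>A\<close> the triangle
  inequality then gives \<open>bdist u z \<le> 3 * bdist w z\<close>, and squaring produces the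
  9.\<close>

lemma berg_maximum_principle:
  assumes w: "cmod w < 1" and A: "A \<subseteq> ball 0 1"
    and M: "\<And>u. u \<in> A \<Longrightarrow> (\<integral>\<^sup>+z. berg u z * indicator A z \<partial>lborel) \<le> M"
    and [measurable]: "A \<in> sets borel"
  shows "(\<integral>\<^sup>+z. berg w z * indicator A z \<partial>lborel) \<le> 9 * M"
proof (cases "A = {}")
  case False
  have lower: "1 - cmod w \<le> bdist w u" if "u \<in> A" for u
    using that A by (intro bdist_ge) auto
  define i where "i = (INF u\<in>A. bdist w u)"
  \<comment> \<open>Positivity of the infimum makes \<open>2 * i\<close> strictly larger, so a
    near-minimiser exists even if the infimum is not attained.\<close>
  have "1 - cmod w \<le> i"
    unfolding i_def using False lower by (intro cINF_greatest)
  then have "i < 2 * i" using w by simp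
  moreover have bdd: "bdd_below (bdist w ` A)"
    using lower by (intro bdd_belowI[of _ "1 - cmod w"]) auto
  ultimately obtain u where u: "u \<in> A" "bdist w u < 2 * i"
    using False by (auto simp: i_def cINF_less_iff)
  have u1: "cmod u < 1" using u A by auto
  have pt: "berg w z * indicator A z \<le> 9 * (berg u z * indicator A z)" for z
  proof (cases "z \<in> A")
    case z: True
    then have z1: "cmod z < 1" using A by auto
    have "i \<le> bdist w z"
      unfolding i_def using bdd z by (intro cINF_lower)
    moreover have "bdist u z \<le> bdist u w + bdist w z"
      using u1 w z1 by (intro bdist_triangle) auto
    ultimately have le: "bdist u z \<le> 3 * bdist w z"
      using u by (simp add: bdist_commute)
    have pos: "0 < bdist u z" "0 < bdist w z"
      using u1 w z1 by (auto intro: bdist_pos)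
    have "(bdist u z)\<^sup>2 \<le> (3 * bdist w z)\<^sup>2"
      using le pos by (intro power_mono) auto
    then have "1 / (bdist w z)\<^sup>2 \<le> 9 * (1 / (bdist u z)\<^sup>2)"
      using pos by (simp add: field_simps power2_eq_square)
    then have "ennreal (1 / (bdist w z)\<^sup>2) \<le> 9 * ennreal (1 / (bdist u z)\<^sup>2)"
      by (subst ennreal_numeral[symmetric], subst ennreal_mult[symmetric]) (auto intro: ennreal_leI)
    then show ?thesis using z u1 w z1 by (simp add: berg_def)
  qed simp
  have "(\<integral>\<^sup>+z. berg w z * indicator A z \<partial>lborel) \<le> (\<integral>\<^sup>+z. 9 * (berg u z * indicator A z) \<partial>lborel)"
    by (intro nn_integral_mono pt)
  also have "\<dots> = 9 * (\<integral>\<^sup>+z. berg u z * indicator A z \<partial>lborel)"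
    by (intro nn_integral_cmult) measurable
  also have "\<dots> \<le> 9 * M"
    using M u by (intro mult_left_mono) auto
  finally show ?thesis .
qed simp

text \<open>By Markov's inequality the potential \<open>g\<close> of \<open>E\<close> exceeds twice
  its mean bound \<open>4608 * pi\<close> on at most half of \<open>E\<close>. On the rest,
  \<open>A\<close>, the smaller potential of \<open>A\<close> is at most \<open>9216 * pi\<close>,
  and the maximum principle carries this to the whole disc with factor 9.\<close>

lemma exists_large_subset_bounded_potential:
  assumes E_meas [measurable]: "E \<in> sets borel" and E: "E \<subseteq> ball 0 1"
  obtains A where "A \<in> sets borel" "A \<subseteq> E" "emeasure lborel E \<le> 2 * emeasure lborel A"
    "\<And>w. (\<integral>\<^sup>+z. berg w z * indicator A z \<partial>lborel) \<le> ennreal (82944 * pi) * indicator (ball 0 1) w"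
proof -
  define g where "g z = (\<integral>\<^sup>+w. berg z w * indicator E w \<partial>lborel)" for z
  have [measurable]: "g \<in> borel_measurable borel"
    unfolding g_def by measurable
  define A B where "A = {z \<in> E. g z \<le> ennreal (9216 * pi)}" and "B = {z \<in> E. \<not> g z \<le> ennreal (9216 * pi)}"
  have [measurable]: "A \<in> sets borel" "B \<in> sets borel"
    unfolding A_def B_def by measurable
  have "ennreal (4608 * pi) * (2 * emeasure lborel B) = ennreal (4608 * pi) * 2 * emeasure lborel B"
    by (simp add: mult.assoc)
  also have "ennreal (4608 * pi) * 2 = ennreal (9216 * pi)"
    by (subst ennreal_numeral[symmetric], subst ennreal_mult[symmetric]) auto
  also have "ennreal (9216 * pi) * emeasure lborel B = (\<integral>\<^sup>+z. ennreal (9216 * pi) * indicator B z \<partial>lborel)"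
    by (simp add: nn_integral_cmult_indicator)
  also have "\<dots> \<le> (\<integral>\<^sup>+z. g z * indicator E z \<partial>lborel)"
    by (intro nn_integral_mono) (auto simp: B_def split: split_indicator)
  also have "\<dots> \<le> ennreal (4608 * pi) * emeasure lborel E"
    unfolding g_def by (intro nn_integral_berg_sets_le E E_meas)
  finally have B_le: "2 * emeasure lborel B \<le> emeasure lborel E"
    by (subst (asm) ennreal_mult_le_mult_iff) auto
  \<comment> \<open>Finite measure allows one copy of |E| to be cancelled below.\<close>
  have fin: "emeasure lborel E < top"
    using emeasure_mono[OF E, of lborel] emeasure_lborel_ball_finite[of "0::complex" 1]
    by (auto intro: le_less_trans)
  have "emeasure lborel E = emeasure lborel A + emeasure lborel B"
    by (subst plus_emeasure) (auto simp: A_def B_def intro!: arg_cong[where f = "emeasure lborel"])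
  then have "emeasure lborel E + emeasure lborel E = 2 * emeasure lborel A + 2 * emeasure lborel B"
    by (simp add: mult_2 ac_simps)
  also have "\<dots> \<le> 2 * emeasure lborel A + emeasure lborel E"
    using B_le by (intro add_left_mono)
  finally have "emeasure lborel E \<le> 2 * emeasure lborel A"
    using less_imp_neq[OF fin] by (simp add: ennreal_add_left_cancel_le add.commute)
  moreover have "(\<integral>\<^sup>+z. berg w z * indicator A z \<partial>lborel) \<le> ennreal (82944 * pi) * indicator (ball 0 1) w" for w
  proof (cases "w \<in> ball 0 1")
    case True
    have "(\<integral>\<^sup>+z. berg u z * indicator A z \<partial>lborel) \<le> ennreal (9216 * pi)" if "u \<in> A" for u
    proof -
      have "(\<integral>\<^sup>+z. berg u z * indicator A z \<partial>lborel) \<le> g u"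
        unfolding g_def by (intro nn_integral_mono) (auto simp: A_def split: split_indicator)
      then show ?thesis using that by (auto simp: A_def)
    qed
    then have "(\<integral>\<^sup>+z. berg w z * indicator A z \<partial>lborel) \<le> 9 * ennreal (9216 * pi)"
      using True E by (intro berg_maximum_principle) (auto simp: A_def)
    also have "9 * ennreal (9216 * pi) = ennreal (82944 * pi)"
      by (subst ennreal_numeral[symmetric], subst ennreal_mult[symmetric]) auto
    finally show ?thesis using True by simp
  qed (simp add: berg_def)
  ultimately show ?thesis
    by (intro that[of A]) (auto simp: A_def)
qed

text \<open>The duality step: on \<open>A\<close> the potential of \<open>H\<close> exceeds
  \<open>t\<close>, while by Tonelli and symmetry its integral over \<open>A\<close> is that of
  \<open>H\<close> against the bounded potential of \<open>A\<close>. Passing from \<open>A\<close>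
  back to \<open>E\<close> doubles the constant.\<close>

lemma weak_type_disc:
  assumes [measurable]: "H \<in> borel_measurable borel"
  shows "t * emeasure lborel {z. t < (\<integral>\<^sup>+w. berg z w * H w \<partial>lborel)}
    \<le> ennreal (165888 * pi) * (\<integral>\<^sup>+w. H w \<partial>lborel)"
proof -
  define T where "T z = (\<integral>\<^sup>+w. berg z w * H w \<partial>lborel)" for z
  have [measurable]: "T \<in> borel_measurable borel"
    unfolding T_def by measurable
  define E where "E = {z. t < T z}"
  have E_meas [measurable]: "E \<in> sets borel" unfolding E_def by measurable
  \<comment> \<open>The cut-off makes \<open>T\<close> vanish off the disc, where it cannot exceed
    \<open>t\<close> in \<open>ennreal\<close>.\<close>
  have "T z = 0" if "z \<notin> ball 0 1" for z
    using that by (simp add: T_def berg_def)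
  then have E1: "E \<subseteq> ball 0 1" by (auto simp: E_def) fastforce
  obtain A where [measurable]: "A \<in> sets borel" and A: "A \<subseteq> E" "emeasure lborel E \<le> 2 * emeasure lborel A"
    "\<And>w. (\<integral>\<^sup>+z. berg w z * indicator A z \<partial>lborel) \<le> ennreal (82944 * pi) * indicator (ball 0 1) w"
    using exists_large_subset_bounded_potential[OF E_meas E1] by blast
  have "t * emeasure lborel A = (\<integral>\<^sup>+z. t * indicator A z \<partial>lborel)"
    by (simp add: nn_integral_cmult_indicator)
  also have "\<dots> \<le> (\<integral>\<^sup>+z. T z * indicator A z \<partial>lborel)"
    using A(1) by (intro nn_integral_mono) (auto simp: E_def less_imp_le split: split_indicator)
  also have "\<dots> = (\<integral>\<^sup>+z. \<integral>\<^sup>+w. berg z w * H w * indicator A z \<partial>lborel \<partial>lborel)"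
    unfolding T_def by (intro nn_integral_cong nn_integral_multc[symmetric]) measurable
  also have "\<dots> = (\<integral>\<^sup>+w. \<integral>\<^sup>+z. berg z w * H w * indicator A z \<partial>lborel \<partial>lborel)"
    by (intro lborel_pair.Fubini') measurable
  also have "\<dots> = (\<integral>\<^sup>+w. H w * (\<integral>\<^sup>+z. berg w z * indicator A z \<partial>lborel) \<partial>lborel)"
    by (subst nn_integral_cmult[symmetric]) (auto simp: berg_commute mult_ac)
  also have "\<dots> \<le> (\<integral>\<^sup>+w. ennreal (82944 * pi) * H w \<partial>lborel)"
  proof (intro nn_integral_mono)
    fix w
    have "(\<integral>\<^sup>+z. berg w z * indicator A z \<partial>lborel) \<le> ennreal (82944 * pi)"
      by (rule order_trans[OF A(3)]) (auto split: split_indicator)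
    then show "H w * (\<integral>\<^sup>+z. berg w z * indicator A z \<partial>lborel) \<le> ennreal (82944 * pi) * H w"
      by (subst mult.commute) (rule mult_right_mono, simp_all)
  qed
  also have "\<dots> = ennreal (82944 * pi) * (\<integral>\<^sup>+w. H w \<partial>lborel)"
    by (intro nn_integral_cmult) measurable
  finally have *: "t * emeasure lborel A \<le> ennreal (82944 * pi) * (\<integral>\<^sup>+w. H w \<partial>lborel)" .
  have "t * emeasure lborel E \<le> 2 * (t * emeasure lborel A)"
    using mult_left_mono[OF A(2), of t] by (simp add: mult_ac)
  also have "\<dots> \<le> 2 * (ennreal (82944 * pi) * (\<integral>\<^sup>+w. H w \<partial>lborel))"
    using * by (intro mult_left_mono) auto
  also have "\<dots> = ennreal (165888 * pi) * (\<integral>\<^sup>+w. H w \<partial>lborel)"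
    unfolding mult.assoc[symmetric]
    by (subst ennreal_numeral[symmetric], subst ennreal_mult[symmetric]) auto
  finally show ?thesis by (simp add: E_def T_def)
qed

section \<open>Absorbing the logarithmic kernel mass by Young's inequality\<close>

lemma logplus_nonneg: "0 \<le> logplus x"
  by (simp add: logplus_def)

lemma logplus_measurable [measurable]: "logplus \<in> borel_measurable borel"
  unfolding logplus_def by measurable

text \<open>Serves for the 3 in the mass bound \<open>n + 3\<close>. Beyond 3, which exceeds e, the
  logarithm is at least 1.\<close>

lemma le_three_plus_mult_logplus:
  assumes "x \<ge> 0"
  shows "x \<le> 3 + x * logplus x"
proof (cases "x \<le> 3")
  case True
  then show ?thesis using mult_nonneg_nonneg[OF assms logplus_nonneg[of x]] by linarith
next
  case False
  then have "ln (exp 1) \<le> ln x" using exp_le by (subst ln_le_cancel_iff) auto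
  then have "x * 1 \<le> x * logplus x" using False by (intro mult_left_mono) (auto simp: logplus_def)
  then show ?thesis by simp
qed

text \<open>The base \<open>4/3 \<ge> exp (1/4)\<close> stays below 2, so the last term is integrable although it is used
  on a shell of area about \<open>2\<^sup>-\<^sup>n\<close>.\<close>

lemma young_logplus:
  assumes "x \<ge> 0"
  shows "x * real n \<le> 8 * (x * logplus x) + 8 * (4/3) ^ n"
proof -
  \<comment> \<open>Dichotomy at \<open>exp b\<close>: below it, \<open>x * b\<close> is at most
    exp(2b) = exp(n/4); above it, \<open>b\<close> is at most the logarithm of
    \<open>x\<close>.\<close>
  define b where "b = real n / 8"
  have "exp (1/4::real) \<le> 4/3"
    using exp_ge_add_one_self[of "-1/4::real"] by (simp add: exp_minus field_simps)
  then have "exp (1/4::real) ^ n \<le> (4/3) ^ n" by (intro power_mono) auto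
  moreover have "exp (1/4::real) ^ n = exp (b + b)"
    by (simp add: b_def flip: exp_of_nat_mult)
  ultimately have e: "exp b * exp b \<le> (4/3) ^ n" by (simp only: exp_add)
  have "x * b \<le> x * logplus x + (4/3) ^ n"
  proof (cases "x \<le> exp b")
    case True
    have "b \<le> exp b" using exp_ge_add_one_self[of b] by linarith
    moreover have "b \<ge> 0" by (simp add: b_def)
    ultimately have "x * b \<le> exp b * exp b"
      using True by (intro mult_mono) auto
    then show ?thesis using e mult_nonneg_nonneg[OF assms logplus_nonneg[of x]] by linarith
  next
    case False
    then have x: "x > exp b" by simp
    then have "x > 0" using less_trans[OF exp_gt_zero] by blast
    then have "b \<le> logplus x" using x by (simp add: logplus_def le_max_iff_disj ln_ge_iff)
    then have "x * b \<le> x * logplus x" using assms by (intro mult_left_mono)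
    then show ?thesis by (simp add: add_increasing2)
  qed
  then show ?thesis by (simp add: b_def)
qed

lemma emeasure_shell_le:
  assumes "0 \<le> r" "r \<le> 1"
  shows "emeasure lborel {w \<in> ball 0 1. 1 - cmod w \<le> r} \<le> ennreal (2 * pi * r)"
proof -
  have ball: "emeasure lborel (ball (0::complex) s) = ennreal (pi * s\<^sup>2)" if "s \<ge> 0" for s
    using emeasure_ball[OF that, of "0::complex"] that
    by (simp add: unit_ball_vol_2 ennreal_mult'' ennreal_power)
  have "{w \<in> ball 0 1. 1 - cmod w \<le> r} = ball (0::complex) 1 - ball 0 (1 - r)" by auto
  then have "emeasure lborel {w \<in> ball 0 1. 1 - cmod w \<le> r}
      = emeasure lborel (ball (0::complex) 1) - emeasure lborel (ball (0::complex) (1 - r))"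
    using assms by (simp add: emeasure_Diff ball subset_ball)
  also have "\<dots> = ennreal (pi * 1\<^sup>2 - pi * (1 - r)\<^sup>2)"
    using assms by (simp add: ball ennreal_minus)
  also have "pi * 1\<^sup>2 - pi * (1 - r)\<^sup>2 = 2 * pi * r - pi * r\<^sup>2"
    by (simp add: power2_eq_square algebra_simps)
  also have "ennreal \<dots> \<le> ennreal (2 * pi * r)" by (intro ennreal_leI) simp
  finally show ?thesis .
qed

text \<open>When 1 - |w| is about 2^-n the mass is at most \<open>16 * pi * (n + 3)\<close>, and
  Young's inequality splits its product with \<open>x\<close>. \<open>V\<close> collects the errors:
  (4/3)^k on a shell of area at most 2 pi / 2^k gives a geometric series of ratio 2/3.\<close>

lemma berg_mass_young:
  obtains V :: "complex \<Rightarrow> ennreal" where "V \<in> borel_measurable borel" "(\<integral>\<^sup>+w. V w \<partial>lborel) < top"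
    "\<And>x w. x \<ge> 0 \<Longrightarrow> ennreal x * (\<integral>\<^sup>+z. berg z w \<partial>lborel) \<le> ennreal (176 * pi) * ennreal (x * logplus x) + V w"
proof -
  define S where "S k = {w \<in> ball 0 1. 1 - cmod w \<le> (1/2) ^ k}" for k :: nat
  have [measurable]: "S k \<in> sets borel" for k unfolding S_def by measurable
  \<comment> \<open>Summing over all nested shells avoids selecting a scale for each
    \<open>w\<close> and keeps \<open>V\<close> measurable; only the term of the actual scale is
    used later.\<close>
  define V where "V w = (\<Sum>k. ennreal (272 * pi * (4/3) ^ k) * indicator (S k) w)" for w
  have V_meas: "V \<in> borel_measurable borel" unfolding V_def by measurable
  have "(\<integral>\<^sup>+w. V w \<partial>lborel) = (\<Sum>k. ennreal (272 * pi * (4/3) ^ k) * emeasure lborel (S k))"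
    unfolding V_def by (subst nn_integral_suminf) (simp_all add: nn_integral_cmult_indicator)
  also have "\<dots> \<le> (\<Sum>k. ennreal (544 * pi\<^sup>2 * (2/3) ^ k))"
  proof (intro suminf_le)
    fix k
    have "ennreal (272 * pi * (4/3) ^ k) * emeasure lborel (S k)
        \<le> ennreal (272 * pi * (4/3) ^ k) * ennreal (2 * pi * (1/2) ^ k)"
      unfolding S_def by (intro mult_left_mono emeasure_shell_le) (auto simp: power_le_one)
    also have "\<dots> = ennreal (544 * pi\<^sup>2 * ((4/3) ^ k * (1/2) ^ k))"
      by (subst ennreal_mult[symmetric]) (auto simp: power2_eq_square mult_ac)
    also have "(4/3) ^ k * (1/2) ^ k = ((2/3) ^ k :: real)"
      by (subst power_mult_distrib[symmetric]) simp
    finally show "ennreal (272 * pi * (4/3) ^ k) * emeasure lborel (S k) \<le> ennreal (544 * pi\<^sup>2 * (2/3) ^ k)" .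
  qed auto
  also have "\<dots> < top"
    by (subst suminf_ennreal2) (auto intro!: summable_mult summable_geometric)
  finally have V_fin: "(\<integral>\<^sup>+w. V w \<partial>lborel) < top" .
  have "ennreal x * (\<integral>\<^sup>+z. berg z w \<partial>lborel) \<le> ennreal (176 * pi) * ennreal (x * logplus x) + V w"
    if x: "x \<ge> 0" for x w
  proof (cases "cmod w < 1")
    case w: True
    obtain n where n: "(1/2) ^ Suc n < 1 - cmod w" "1 - cmod w \<le> (1/2) ^ n"
      using dyadic_scale[of "1 - cmod w"] w by auto
    have "(\<integral>\<^sup>+z. berg z w \<partial>lborel) = (\<integral>\<^sup>+z. ennreal (1 / (bdist w z)\<^sup>2) * indicator (ball 0 1) z \<partial>lborel)"
      using w by (intro nn_integral_cong) (auto simp: berg_def bdist_commute split: split_indicator)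
    also have "\<dots> \<le> ennreal (16 * pi * (real n + 3))"
      using w n by (intro nn_integral_bdist_inverse_square_le) auto
    finally have "ennreal x * (\<integral>\<^sup>+z. berg z w \<partial>lborel) \<le> ennreal x * ennreal (16 * pi * (real n + 3))"
      by (intro mult_left_mono) auto
    also have "\<dots> = ennreal (16 * pi * (x * real n + 3 * x))"
      using x by (subst ennreal_mult[symmetric]) (auto simp: algebra_simps)
    \<comment> \<open>Here 11 = 8 + 3 and 17 = 8 + 9, the 9 being absorbed through (4/3)^n \<ge>
      1.\<close>
    also have "\<dots> \<le> ennreal (16 * pi * (11 * (x * logplus x) + 17 * (4/3) ^ n))"
    proof (intro ennreal_leI mult_left_mono)
      have "1 \<le> (4/3::real) ^ n" by (intro one_le_power) auto
      then show "x * real n + 3 * x \<le> 11 * (x * logplus x) + 17 * (4/3) ^ n"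
        using young_logplus[OF x, of n] le_three_plus_mult_logplus[OF x] by linarith
    qed auto
    also have "\<dots> = ennreal (176 * pi * (x * logplus x) + 272 * pi * (4/3) ^ n)"
      by (simp add: algebra_simps)
    also have "\<dots> = ennreal (176 * pi) * ennreal (x * logplus x) + ennreal (272 * pi * (4/3) ^ n) * indicator (S n) w"
      using x w n logplus_nonneg[of x] by (simp add: S_def ennreal_plus ennreal_mult)
    also have "ennreal (272 * pi * (4/3) ^ n) * indicator (S n) w \<le> V w"
    proof -
      define c where "c k = ennreal (272 * pi * (4/3) ^ k) * (indicator (S k) w :: ennreal)" for k
      have "sum c {n} \<le> suminf c" by (intro sum_le_suminf) auto
      then have "c n \<le> suminf c" by simp
      then show ?thesis unfolding V_def c_def .
    qed
    finally show ?thesis by (simp add: add_left_mono)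
  qed (simp add: berg_def)
  then show ?thesis using that V_meas V_fin by blast
qed

section \<open>Iteration to the bidisc\<close>

text \<open>For fixed \<open>z2\<close> the disc bound in \<open>z1\<close> is applied to
  \<open>H z2\<close>, the partial integral in the second variable. Integrating over
  \<open>z2\<close> and using Tonelli leaves the mass of the second kernel.\<close>

lemma weak_type_bidisc:
  fixes F :: "complex \<times> complex \<Rightarrow> ennreal"
  assumes [measurable]: "F \<in> borel_measurable borel"
  shows "t * emeasure lborel {z. t < (\<integral>\<^sup>+w. berg (fst z) (fst w) * (berg (snd z) (snd w) * F w) \<partial>lborel)}
    \<le> ennreal (165888 * pi) * (\<integral>\<^sup>+w. F w * (\<integral>\<^sup>+z. berg z (snd w) \<partial>lborel) \<partial>lborel)"
proof -
  have F_meas [measurable]: "F \<in> borel_measurable (borel \<Otimes>\<^sub>M borel)" by (simp add: borel_prod)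
  define H where "H z2 w1 = (\<integral>\<^sup>+w2. berg z2 w2 * F (w1, w2) \<partial>lborel)" for z2 w1
  have H_meas [measurable]: "(\<lambda>x. H (f x) (g x)) \<in> borel_measurable M"
    if [measurable]: "f \<in> borel_measurable M" "g \<in> borel_measurable M" for f g and M :: "'b measure"
    unfolding H_def by measurable
  define G where "G z1 z2 = (\<integral>\<^sup>+w1. berg z1 w1 * H z2 w1 \<partial>lborel)" for z1 z2
  have G_meas [measurable]: "(\<lambda>x. G (f x) (g x)) \<in> borel_measurable M"
    if [measurable]: "f \<in> borel_measurable M" "g \<in> borel_measurable M" for f g and M :: "'b measure"
    unfolding G_def by measurable
  have "(\<integral>\<^sup>+w. berg (fst z) (fst w) * (berg (snd z) (snd w) * F w) \<partial>lborel) = G (fst z) (snd z)" for z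
  proof -
    have "(\<integral>\<^sup>+w. berg (fst z) (fst w) * (berg (snd z) (snd w) * F w) \<partial>lborel)
      = (\<integral>\<^sup>+w1. \<integral>\<^sup>+w2. berg (fst z) w1 * (berg (snd z) w2 * F (w1, w2)) \<partial>lborel \<partial>lborel)"
      unfolding lborel_prod[symmetric] by (subst lborel.nn_integral_fst[symmetric]) simp_all
    also have "\<dots> = G (fst z) (snd z)"
      unfolding G_def H_def by (intro nn_integral_cong nn_integral_cmult) measurable
    finally show ?thesis .
  qed
  then have "t * emeasure lborel {z. t < (\<integral>\<^sup>+w. berg (fst z) (fst w) * (berg (snd z) (snd w) * F w) \<partial>lborel)}
    = t * emeasure lborel {z. t < G (fst z) (snd z)}" by simp
  also have "emeasure lborel {z. t < G (fst z) (snd z)}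
      = (\<integral>\<^sup>+z2. emeasure lborel {z1. t < G z1 z2} \<partial>lborel)"
  proof -
    have "{z \<in> space (lborel \<Otimes>\<^sub>M lborel). t < G (fst z) (snd z)} \<in> sets (lborel \<Otimes>\<^sub>M lborel)"
      by measurable
    then have "{z. t < G (fst z) (snd z)} \<in> sets (lborel \<Otimes>\<^sub>M lborel)"
      by (simp add: space_pair_measure)
    then show ?thesis
      unfolding lborel_prod[symmetric] by (subst lborel_pair.emeasure_pair_measure_alt2) (auto simp: vimage_def)
  qed
  also have "t * \<dots> = (\<integral>\<^sup>+z2. t * emeasure lborel {z1. t < G z1 z2} \<partial>lborel)"
  proof (intro nn_integral_cmult[symmetric])
    \<comment> \<open>Writing the measure of a slice as an integral shows that it is measurable in
      \<open>z2\<close>.\<close>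
    have "emeasure lborel {z1. t < G z1 z2} = (\<integral>\<^sup>+z1. (if t < G z1 z2 then 1 else 0) \<partial>lborel)" for z2
    proof -
      have "{z1. t < G z1 z2} \<in> sets lborel" by measurable
      then have "emeasure lborel {z1. t < G z1 z2} = (\<integral>\<^sup>+z1. indicator {z1. t < G z1 z2} z1 \<partial>lborel)"
        by (rule nn_integral_indicator[symmetric])
      also have "\<dots> = (\<integral>\<^sup>+z1. (if t < G z1 z2 then 1 else 0) \<partial>lborel)"
        by (intro nn_integral_cong) simp
      finally show ?thesis .
    qed
    then show "(\<lambda>z2. emeasure lborel {z1. t < G z1 z2}) \<in> borel_measurable lborel" by simp
  qed
  also have "\<dots> \<le> (\<integral>\<^sup>+z2. ennreal (165888 * pi) * (\<integral>\<^sup>+w1. H z2 w1 \<partial>lborel) \<partial>lborel)"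
    unfolding G_def by (intro nn_integral_mono weak_type_disc) measurable
  also have "\<dots> = ennreal (165888 * pi) * (\<integral>\<^sup>+z2. \<integral>\<^sup>+w1. H z2 w1 \<partial>lborel \<partial>lborel)"
    by (intro nn_integral_cmult) measurable
  also have "(\<integral>\<^sup>+z2. \<integral>\<^sup>+w1. H z2 w1 \<partial>lborel \<partial>lborel) = (\<integral>\<^sup>+w1. \<integral>\<^sup>+z2. H z2 w1 \<partial>lborel \<partial>lborel)"
    by (intro lborel_pair.Fubini') measurable
  also have "\<dots> = (\<integral>\<^sup>+w1. \<integral>\<^sup>+w2. F (w1, w2) * (\<integral>\<^sup>+z2. berg z2 w2 \<partial>lborel) \<partial>lborel \<partial>lborel)"
  proof (rule nn_integral_cong)
    fix w1 :: complex
    have "(\<integral>\<^sup>+z2. H z2 w1 \<partial>lborel) = (\<integral>\<^sup>+w2. \<integral>\<^sup>+z2. berg z2 w2 * F (w1, w2) \<partial>lborel \<partial>lborel)"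
      unfolding H_def by (intro lborel_pair.Fubini') measurable
    also have "\<dots> = (\<integral>\<^sup>+w2. F (w1, w2) * (\<integral>\<^sup>+z2. berg z2 w2 \<partial>lborel) \<partial>lborel)"
      by (intro nn_integral_cong) (simp add: nn_integral_multc mult.commute)
    finally show "(\<integral>\<^sup>+z2. H z2 w1 \<partial>lborel) = (\<integral>\<^sup>+w2. F (w1, w2) * (\<integral>\<^sup>+z2. berg z2 w2 \<partial>lborel) \<partial>lborel)" .
  qed
  also have "\<dots> = (\<integral>\<^sup>+w. F w * (\<integral>\<^sup>+z. berg z (snd w) \<partial>lborel) \<partial>lborel)"
    unfolding lborel_prod[symmetric] by (subst lborel.nn_integral_fst[symmetric]) simp_all
  finally show ?thesis .
qed

section \<open>From the positive operator to the Bergman projection\<close>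

lemma norm_bergman_kernel_le:
  assumes "z \<in> bidisc" "w \<in> bidisc"
  shows "ennreal (norm (bergman_kernel z w)) \<le> berg (fst z) (fst w) * berg (snd z) (snd w)"
proof -
  have "norm (bergman_kernel z w) = (1 / pi\<^sup>2) * (1 / (bdist (fst z) (fst w))\<^sup>2 * (1 / (bdist (snd z) (snd w))\<^sup>2))"
    by (simp add: bergman_kernel_def bdist_def norm_mult norm_divide norm_power power2_eq_square)
  also have "\<dots> \<le> 1 * (1 / (bdist (fst z) (fst w))\<^sup>2 * (1 / (bdist (snd z) (snd w))\<^sup>2))"
  proof (rule mult_right_mono)
    have "1 \<le> pi" using pi_gt3 by linarith
    then show "1 / pi\<^sup>2 \<le> 1" by (simp add: one_le_power)
  qed simp
  finally show ?thesis
    using assms by (auto simp: berg_def bidisc_def mem_Times_iff ennreal_mult'[symmetric] intro!: ennreal_leI)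
qed

lemma bergman_proj_le_potential:
  assumes z: "z \<in> bidisc"
  shows "ennreal (norm (bergman_proj f z))
    \<le> (\<integral>\<^sup>+w. berg (fst z) (fst w) * (berg (snd z) (snd w) * ennreal (indicator bidisc w * norm (f w))) \<partial>lebesgue)"
proof (cases "integrable lebesgue (\<lambda>w. indicator bidisc w *\<^sub>R (bergman_kernel z w * f w))")
  case True
  have "ennreal (norm (bergman_proj f z))
      \<le> (\<integral>\<^sup>+w. ennreal (norm (indicator bidisc w *\<^sub>R (bergman_kernel z w * f w))) \<partial>lebesgue)"
    unfolding bergman_proj_def set_lebesgue_integral_def by (rule integral_norm_bound_ennreal[OF True])
  also have "\<dots> \<le> (\<integral>\<^sup>+w. berg (fst z) (fst w) * (berg (snd z) (snd w) * ennreal (indicator bidisc w * norm (f w))) \<partial>lebesgue)"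
  proof (intro nn_integral_mono)
    fix w
    show "ennreal (norm (indicator bidisc w *\<^sub>R (bergman_kernel z w * f w)))
      \<le> berg (fst z) (fst w) * (berg (snd z) (snd w) * ennreal (indicator bidisc w * norm (f w)))"
    proof (cases "w \<in> bidisc")
      case True
      then show ?thesis
        using mult_right_mono[OF norm_bergman_kernel_le[OF z True], of "ennreal (norm (f w))"]
        by (simp add: norm_mult ennreal_mult mult.assoc)
    qed simp
  qed
  finally show ?thesis .
next
  case False
  \<comment> \<open>The Bochner integral of a non-integrable function is 0 by convention, so the
    bound is trivial here.\<close>
  then have "bergman_proj f z = 0"
    unfolding bergman_proj_def set_lebesgue_integral_def by (rule not_integrable_integral_eq)
  then show ?thesis by simp
qed

lemma bidisc_in_sets_borel [measurable]: "bidisc \<in> sets borel"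
  unfolding bidisc_def by (intro borel_open open_Times open_ball)

text \<open>The Young-type bound turns the right-hand side of the bidisc estimate into
  \<open>176 * pi\<close> times the modular plus the integral of \<open>V (snd w)\<close> over the
  bidisc, at most the area of the disc times the finite integral of \<open>V\<close>.\<close>

lemma weak_type_unit_modular:
  obtains C :: real where "C > 0"
    "\<And>f t. f \<in> borel_measurable (restrict_space lebesgue bidisc) \<Longrightarrow> orlicz_modular 1 bidisc f \<le> 1 \<Longrightarrow> t > 0 \<Longrightarrow>
      emeasure lebesgue {z \<in> bidisc. norm (bergman_proj f z) > t} \<le> ennreal (C / t)"
proof -
  obtain V where [measurable]: "V \<in> borel_measurable borel" and V: "(\<integral>\<^sup>+w. V w \<partial>lborel) < top"
    "\<And>x w. x \<ge> 0 \<Longrightarrow> ennreal x * (\<integral>\<^sup>+z. berg z w \<partial>lborel) \<le> ennreal (176 * pi) * ennreal (x * logplus x) + V w"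
    by (rule berg_mass_young) blast
  define D where "D = ennreal (165888 * pi) *
    (ennreal (176 * pi) + emeasure lborel (ball (0::complex) 1) * (\<integral>\<^sup>+w. V w \<partial>lborel))"
  have "D < top"
    unfolding D_def using V(1) emeasure_lborel_ball_finite[of "0::complex" 1] by (auto simp: ennreal_mult_less_top)
  define C where "C = enn2real D + 1"
  have "D = ennreal (enn2real D)" using \<open>D < top\<close> by simp
  also have "\<dots> \<le> ennreal C" unfolding C_def by (intro ennreal_leI) simp
  finally have C: "C > 0" "D \<le> ennreal C" by (simp_all add: C_def add_nonneg_pos)
  have "emeasure lebesgue {z \<in> bidisc. norm (bergman_proj f z) > t} \<le> ennreal (C / t)"
    if f: "f \<in> borel_measurable (restrict_space lebesgue bidisc)" and mod: "orlicz_modular 1 bidisc f \<le> 1"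
      and t: "t > 0" for f and t :: real
  proof -
    have "(\<lambda>w. indicator bidisc w *\<^sub>R f w) \<in> borel_measurable lebesgue"
      using f by (subst (asm) borel_measurable_restrict_space_iff) auto
    then have "(\<lambda>w. norm (indicator bidisc w *\<^sub>R f w)) \<in> borel_measurable lebesgue" by measurable
    then have "(\<lambda>w. indicator bidisc w * norm (f w)) \<in> borel_measurable lebesgue" by simp
    \<comment> \<open>The potential estimates concern Borel functions, so |f| on the bidisc is
      replaced by a Borel function equal to it almost everywhere.\<close>
    then obtain g where g [measurable]: "g \<in> borel_measurable lborel"
      and ae: "AE w in lborel. indicator bidisc w * norm (f w) = g w"
      using completion_ex_borel_measurable_real by blast
    have [measurable]: "g \<in> borel_measurable borel" using g by simp
    have ae': "AE w in lebesgue. indicator bidisc w * norm (f w) = g w"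
      using ae by (rule AE_completion)
    define F where "F w = ennreal (g w) * indicator bidisc w" for w
    have [measurable]: "F \<in> borel_measurable borel" unfolding F_def by measurable
    then have [measurable]: "F \<in> borel_measurable (borel \<Otimes>\<^sub>M borel)" by (simp add: borel_prod)
    define G where "G z = (\<integral>\<^sup>+w. berg (fst z) (fst w) * (berg (snd z) (snd w) * F w) \<partial>lborel)" for z
    have [measurable]: "G \<in> borel_measurable borel"
      unfolding G_def borel_prod[symmetric] lborel_prod[symmetric] by measurable
    have G: "ennreal (norm (bergman_proj f z)) \<le> G z" if z: "z \<in> bidisc" for z
    proof -
      have "ennreal (norm (bergman_proj f z))
          \<le> (\<integral>\<^sup>+w. berg (fst z) (fst w) * (berg (snd z) (snd w) * ennreal (indicator bidisc w * norm (f w))) \<partial>lebesgue)"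
        by (rule bergman_proj_le_potential[OF z])
      also have "\<dots> = (\<integral>\<^sup>+w. berg (fst z) (fst w) * (berg (snd z) (snd w) * F w) \<partial>lebesgue)"
        using ae' by (intro nn_integral_cong_AE) (auto simp: F_def elim!: eventually_mono split: split_indicator)
      also have "\<dots> = G z"
        unfolding G_def by (rule nn_integral_completion)
      finally show ?thesis .
    qed
    have "ennreal t * emeasure lebesgue {z \<in> bidisc. norm (bergman_proj f z) > t}
        \<le> ennreal t * emeasure lborel {z. ennreal t < G z}"
    proof (intro mult_left_mono)
      have G_set: "{z. ennreal t < G z} \<in> sets borel" by measurable
      \<comment> \<open>Monotonicity asks only that the larger set be measurable, so measurability
        of the projection itself is not at issue.\<close>
      have "{z \<in> bidisc. norm (bergman_proj f z) > t} \<subseteq> {z. ennreal t < G z}"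
        using t by (auto intro!: less_le_trans[OF _ G] simp: ennreal_less_iff)
      then have "emeasure lebesgue {z \<in> bidisc. norm (bergman_proj f z) > t} \<le> emeasure lebesgue {z. ennreal t < G z}"
        using G_set by (intro emeasure_mono) auto
      also have "\<dots> = emeasure lborel {z. ennreal t < G z}" using G_set by simp
      finally show "emeasure lebesgue {z \<in> bidisc. norm (bergman_proj f z) > t} \<le> emeasure lborel {z. ennreal t < G z}" .
    qed simp
    also have "\<dots> \<le> ennreal (165888 * pi) * (\<integral>\<^sup>+w. F w * (\<integral>\<^sup>+z. berg z (snd w) \<partial>lborel) \<partial>lborel)"
      unfolding G_def by (intro weak_type_bidisc) measurable
    also have "\<dots> \<le> D"
      unfolding D_def
    proof (intro mult_left_mono)
      have [measurable]: "(\<lambda>w. V (snd w)) \<in> borel_measurable (borel :: (complex \<times> complex) measure)"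
        unfolding borel_prod[symmetric] by measurable
      have V_le: "(\<integral>\<^sup>+w. V (snd w) * indicator bidisc w \<partial>lborel)
          \<le> emeasure lborel (ball (0::complex) 1) * (\<integral>\<^sup>+w. V w \<partial>lborel)"
      proof -
        have "(\<integral>\<^sup>+w. V (snd w) * indicator bidisc w \<partial>lborel)
            \<le> (\<integral>\<^sup>+w. indicator (ball (0::complex) 1) (fst w) * V (snd w) \<partial>(lborel \<Otimes>\<^sub>M lborel))"
          unfolding lborel_prod by (intro nn_integral_mono) (auto simp: bidisc_def split: split_indicator)
        also have "\<dots> = (\<integral>\<^sup>+w1. \<integral>\<^sup>+w2. indicator (ball (0::complex) 1) w1 * V w2 \<partial>lborel \<partial>lborel)"
          by (subst lborel.nn_integral_fst[symmetric]) simp_all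
        also have "\<dots> = emeasure lborel (ball (0::complex) 1) * (\<integral>\<^sup>+w. V w \<partial>lborel)"
          by (simp add: nn_integral_cmult nn_integral_multc)
        finally show ?thesis .
      qed
      have "(\<integral>\<^sup>+w. F w * (\<integral>\<^sup>+z. berg z (snd w) \<partial>lborel) \<partial>lborel)
          \<le> (\<integral>\<^sup>+w. ennreal (176 * pi) * (ennreal (g w * logplus (g w)) * indicator bidisc w) + V (snd w) * indicator bidisc w \<partial>lborel)"
      proof (intro nn_integral_mono_AE)
        show "AE w in lborel. F w * (\<integral>\<^sup>+z. berg z (snd w) \<partial>lborel)
          \<le> ennreal (176 * pi) * (ennreal (g w * logplus (g w)) * indicator bidisc w) + V (snd w) * indicator bidisc w"
          using ae
        proof (rule eventually_mono)
          fix w assume "indicator bidisc w * norm (f w) = g w"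
          then have "g w \<ge> 0" by (metis indicator_pos_le mult_nonneg_nonneg norm_ge_zero)
          then show "F w * (\<integral>\<^sup>+z. berg z (snd w) \<partial>lborel)
            \<le> ennreal (176 * pi) * (ennreal (g w * logplus (g w)) * indicator bidisc w) + V (snd w) * indicator bidisc w"
            using V(2)[of "g w" "snd w"] by (auto simp: F_def split: split_indicator)
        qed
      qed
      also have "\<dots> = ennreal (176 * pi) * (\<integral>\<^sup>+w. ennreal (g w * logplus (g w)) * indicator bidisc w \<partial>lborel)
          + (\<integral>\<^sup>+w. V (snd w) * indicator bidisc w \<partial>lborel)"
        by (simp add: nn_integral_add nn_integral_cmult)
      also have "(\<integral>\<^sup>+w. ennreal (g w * logplus (g w)) * indicator bidisc w \<partial>lborel)
          = (\<integral>\<^sup>+w. ennreal (g w * logplus (g w)) * indicator bidisc w \<partial>lebesgue)"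
        by (rule nn_integral_completion[symmetric])
      also have "\<dots> = orlicz_modular 1 bidisc f"
        unfolding orlicz_modular_def using ae'
        by (intro nn_integral_cong_AE) (auto elim!: eventually_mono split: split_indicator)
      also have "ennreal (176 * pi) * orlicz_modular 1 bidisc f + (\<integral>\<^sup>+w. V (snd w) * indicator bidisc w \<partial>lborel)
          \<le> ennreal (176 * pi) * 1 + emeasure lborel (ball (0::complex) 1) * (\<integral>\<^sup>+w. V w \<partial>lborel)"
        by (intro add_mono mult_left_mono mod V_le) simp
      finally show "(\<integral>\<^sup>+w. F w * (\<integral>\<^sup>+z. berg z (snd w) \<partial>lborel) \<partial>lborel)
          \<le> ennreal (176 * pi) + emeasure lborel (ball (0::complex) 1) * (\<integral>\<^sup>+w. V w \<partial>lborel)"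
        by simp
    qed simp
    also have "D \<le> ennreal C" by (rule C)
    also have "ennreal C = ennreal t * ennreal (C / t)"
      using t C by (subst ennreal_mult[symmetric]) auto
    finally show ?thesis
      using t by (subst (asm) ennreal_mult_le_mult_iff) auto
  qed
  then show ?thesis using that C by blast
qed

section \<open>Homogeneity and passage to the Luxemburg norm\<close>

theorem theorem3p5:
  "\<exists>C>0. \<forall>f \<in> LlogL 1 bidisc. \<forall>t::real. t > 0 \<longrightarrow>
     emeasure lebesgue {z \<in> bidisc. norm (bergman_proj f z) > t}
       \<le> ennreal (C * LlogL_norm 1 bidisc f / t)"
proof -
  obtain C :: real where C: "C > 0"
    "\<And>f t. f \<in> borel_measurable (restrict_space lebesgue bidisc) \<Longrightarrow> orlicz_modular 1 bidisc f \<le> 1 \<Longrightarrow> t > 0 \<Longrightarrow>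
      emeasure lebesgue {z \<in> bidisc. norm (bergman_proj f z) > t} \<le> ennreal (C / t)"
    by (rule weak_type_unit_modular) blast
  have "emeasure lebesgue {z \<in> bidisc. norm (bergman_proj f z) > t} \<le> ennreal (C * LlogL_norm 1 bidisc f / t)"
    if f: "f \<in> LlogL 1 bidisc" and t: "t > 0" for f and t :: real
  proof -
    define S where "S = {s::real. s > 0 \<and> orlicz_modular 1 bidisc (\<lambda>x. f x / of_real s) \<le> 1}"
    have S: "S \<noteq> {}" using f by (auto simp: LlogL_def S_def)
    have f_meas [measurable]: "f \<in> borel_measurable (restrict_space lebesgue bidisc)"
      using f by (auto simp: LlogL_def)
    let ?m = "emeasure lebesgue {z \<in> bidisc. norm (bergman_proj f z) > t}"
    have le: "?m \<le> ennreal (C * s / t)" if s: "s \<in> S" for s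
    proof -
      have s0: "s > 0" using s by (simp add: S_def)
      \<comment> \<open>Division by a constant commutes with the integral even where the integrand
        is not integrable.\<close>
      have "bergman_proj (\<lambda>x. f x / of_real s) z = bergman_proj f z / of_real s" for z
        by (simp add: bergman_proj_def set_lebesgue_integral_def flip: integral_divide_zero)
      then have "{z \<in> bidisc. norm (bergman_proj f z) > t}
          = {z \<in> bidisc. norm (bergman_proj (\<lambda>x. f x / of_real s) z) > t / s}"
        using s0 by (simp add: norm_divide divide_less_cancel)
      also have "emeasure lebesgue \<dots> \<le> ennreal (C / (t / s))"
        using s s0 t by (intro C) (auto simp: S_def)
      finally show ?thesis by simp
    qed
    then have fin: "?m < top" using S by (meson all_not_in_conv ennreal_less_top le_less_trans)
    \<comment> \<open>The bound is recast as a lower bound for all admissible \<open>s\<close>, so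
      that it passes to the infimum whether or not the infimum is admissible.\<close>
    have "t / C * enn2real ?m \<le> s" if s: "s \<in> S" for s
    proof -
      have "enn2real ?m \<le> C * s / t"
        using le[OF s] s C t by (intro enn2real_leI) (auto simp: S_def)
      then show ?thesis using C t by (simp add: field_simps)
    qed
    then have "t / C * enn2real ?m \<le> LlogL_norm 1 bidisc f"
      unfolding LlogL_norm_def S_def[symmetric] using S by (intro cInf_greatest)
    then have "enn2real ?m \<le> C * LlogL_norm 1 bidisc f / t"
      using C t by (simp add: field_simps)
    then have "ennreal (enn2real ?m) \<le> ennreal (C * LlogL_norm 1 bidisc f / t)" by (rule ennreal_leI)
    then show ?thesis using fin by simp
  qed
  then show ?thesis using C by blast
qed

end
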